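(* Let $\mathcal{E}$ be an arbitrary biordered set with underlying set $E$. A word $w\in E^*$ represents a regular element of $\mathsf{IG}(\mathcal{E})$ if and only if $w\equiv uev$ for some $u,v\in E^*$ and $e\in E$ such that $ue\ \mathscr{L}\ e\ \mathscr{R}\ ev$ in $\mathsf{IG}(\mathcal{E})$; in which case $e\ \mathscr{D}\ w$ in $\mathsf{IG}(\mathcal{E})$.
   Context: For a semigroup $S$ with set of idempotents $E=E(S)$, a pair $(e,f)\in E\times E$ is a basic pair if $\{e,f\}\cap\{ef,fe\}\neq\varnothing$ (products in $S$); then $ef$ is again an idempotent. The biordered set of $S$ is the partial algebra $\mathcal{E}=(E,* )$ in which $e*f=ef$ if $(e,f)$ is a basic pair, and $e*f$ is undefined otherwise. A biordered set is a partial algebra arising in this way from some semigroup. The free idempotent generated semigroup over $\mathcal{E}$ is the semigroup given by the presentation $\mathsf{IG}(\mathcal{E})=\langle E\mid ef=e*f\ ((e,f)\text{ a basic pair})\rangle$, where $ef$ is the word of length 2 and $e*f$ is a single letter. The idempotents of $\mathsf{IG}(\mathcal{E})$ are exactly the elements represented by the letters $e\in E$, distinct letters represent distinct elements, and the biordered set of $\mathsf{IG}(\mathcal{E})$ is $\mathcal{E}$ (Easdown). $E^*$ is the set of all words over $E$, including the empty word (which represents no element of the semigroup; $u$, $v$ may be empty). For words, $\equiv$ denotes identity as words, $=$ denotes equality of the represented elements, and Green's relations $\mathscr{R},\mathscr{L},\mathscr{D}$ between words refer to the elements of $\mathsf{IG}(\mathcal{E})$ they represent. An element $a$ of a semigroup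 is regular if $aa'a=a$ for some $a'$. *)

theory Defs
  imports "HOL-Algebra.Congruence"
begin

section \<open>Semigroups, idempotents, regularity and Green's relations\<close>

record 'a sgrp = "'a partial_object" +
  sgmult :: "'a \<Rightarrow> 'a \<Rightarrow> 'a" (infixl "\<cdot>\<index>" 70)

text \<open>The carrier may be empty: the free idempotent generated semigroup over an empty
  biordered set (e.g. that of the additive semigroup of positive integers) is empty.\<close>

locale sgrp =
  fixes S :: "('a, 'm) sgrp_scheme" (structure)
  assumes mult_closed: "\<lbrakk>x \<in> carrier S; y \<in> carrier S\<rbrakk> \<Longrightarrow> x \<cdot> y \<in> carrier S"
    and mult_assoc: "\<lbrakk>x \<in> carrier S; y \<in> carrier S; z \<in> carrier S\<rbrakk> \<Longrightarrow> (x \<cdot> y) \<cdot> z = x \<cdot> (y \<cdot> z)"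

definition idempotents :: "('a, 'm) sgrp_scheme \<Rightarrow> 'a set" where
  "idempotents S = {e \<in> carrier S. e \<cdot>\<^bsub>S\<^esub> e = e}"

definition regular_element :: "('a, 'm) sgrp_scheme \<Rightarrow> 'a \<Rightarrow> bool" where
  "regular_element S a \<longleftrightarrow>
     a \<in> carrier S \<and> (\<exists>a' \<in> carrier S. (a \<cdot>\<^bsub>S\<^esub> a') \<cdot>\<^bsub>S\<^esub> a = a)"

text \<open>The principal one-sided ideals $S^1a = \{a\} \cup Sa$ and $aS^1 = \{a\} \cup aS$.\<close>

definition left_ideal :: "('a, 'm) sgrp_scheme \<Rightarrow> 'a \<Rightarrow> 'a set" where
  "left_ideal S a = insert a {x \<cdot>\<^bsub>S\<^esub> a | x. x \<in> carrier S}"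

definition right_ideal :: "('a, 'm) sgrp_scheme \<Rightarrow> 'a \<Rightarrow> 'a set" where
  "right_ideal S a = insert a {a \<cdot>\<^bsub>S\<^esub> x | x. x \<in> carrier S}"

definition green_L :: "('a, 'm) sgrp_scheme \<Rightarrow> 'a \<Rightarrow> 'a \<Rightarrow> bool" where
  "green_L S a b \<longleftrightarrow> a \<in> carrier S \<and> b \<in> carrier S \<and> left_ideal S a = left_ideal S b"

definition green_R :: "('a, 'm) sgrp_scheme \<Rightarrow> 'a \<Rightarrow> 'a \<Rightarrow> bool" where
  "green_R S a b \<longleftrightarrow> a \<in> carrier S \<and> b \<in> carrier S \<and> right_ideal S a = right_ideal S b"

definition green_D :: "('a, 'm) sgrp_scheme \<Rightarrow> 'a \<Rightarrow> 'a \<Rightarrow> bool" where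
  "green_D S = green_L S OO green_R S"


section \<open>Biordered sets\<close>

record 'a partial_algebra = "'a partial_object" +
  pmult :: "'a \<Rightarrow> 'a \<Rightarrow> 'a option"

definition basic_pair :: "('a, 'm) sgrp_scheme \<Rightarrow> 'a \<Rightarrow> 'a \<Rightarrow> bool" where
  "basic_pair S e f \<longleftrightarrow> e \<in> idempotents S \<and> f \<in> idempotents S \<and>
     {e, f} \<inter> {e \<cdot>\<^bsub>S\<^esub> f, f \<cdot>\<^bsub>S\<^esub> e} \<noteq> {}"

definition biordered_set_of :: "('a, 'm) sgrp_scheme \<Rightarrow> 'a partial_algebra" where
  "biordered_set_of S =
     \<lparr>carrier = idempotents S,
      pmult = (\<lambda>e f. if basic_pair S e f then Some (e \<cdot>\<^bsub>S\<^esub> f) else None)\<rparr>"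

text \<open>The semigroup ranges over all carriers inside the type \<^typ>\<open>'a\<close>. As the underlying set of
  a biordered set consists of elements of the semigroup, no semigroup is lost when
  \<^typ>\<open>'a\<close> is a type variable.\<close>

definition biordered_set :: "'a partial_algebra \<Rightarrow> bool" where
  "biordered_set \<E> \<longleftrightarrow> (\<exists>S :: 'a sgrp. sgrp S \<and> \<E> = biordered_set_of S)"


section \<open>Semigroup presentations\<close>

abbreviation nonempty_words :: "'a set \<Rightarrow> 'a list set" where
  "nonempty_words A \<equiv> lists A - {[]}"

text \<open>The least congruence on the free semigroup over \<open>A\<close> that contains \<open>R\<close>.\<close>

inductive_set pres_cong :: "'a set \<Rightarrow> ('a list \<times> 'a list) set \<Rightarrow> ('a list \<times> 'a list) set"
  for A :: "'a set" and R :: "('a list \<times> 'a list) set" where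
  rel: "\<lbrakk>(u, v) \<in> R; u \<in> nonempty_words A; v \<in> nonempty_words A\<rbrakk> \<Longrightarrow> (u, v) \<in> pres_cong A R"
| refl: "u \<in> nonempty_words A \<Longrightarrow> (u, u) \<in> pres_cong A R"
| sym: "(u, v) \<in> pres_cong A R \<Longrightarrow> (v, u) \<in> pres_cong A R"
| trans: "\<lbrakk>(u, v) \<in> pres_cong A R; (v, w) \<in> pres_cong A R\<rbrakk> \<Longrightarrow> (u, w) \<in> pres_cong A R"
| append: "\<lbrakk>(u, v) \<in> pres_cong A R; (u', v') \<in> pres_cong A R\<rbrakk> \<Longrightarrow> (u @ u', v @ v') \<in> pres_cong A R"

text \<open>The product of two classes is the class of the concatenation of any two
  representatives, see \<open>presented_mult\<close> below.\<close>

definition presented_sgrp :: "'a set \<Rightarrow> ('a list \<times> 'a list) set \<Rightarrow> 'a list set sgrp" where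
  "presented_sgrp A R =
     \<lparr>carrier = nonempty_words A // pres_cong A R,
      sgmult = (\<lambda>X Y. \<Union>x\<in>X. \<Union>y\<in>Y. pres_cong A R `` {x @ y})\<rparr>"

lemma pres_cong_words:
  "(u, v) \<in> pres_cong A R \<Longrightarrow> u \<in> nonempty_words A \<and> v \<in> nonempty_words A"
  by (induction rule: pres_cong.induct) auto

lemma equiv_pres_cong: "equiv (nonempty_words A) (pres_cong A R)"
proof (rule equivI)
  show "pres_cong A R \<subseteq> nonempty_words A \<times> nonempty_words A"
    by (rule subrelI) (rule SigmaI; simp only: pres_cong_words)
  show "refl_on (nonempty_words A) (pres_cong A R)"
    by (rule refl_onI) (rule pres_cong.refl)
  show "Relation.sym (pres_cong A R)"
    by (rule symI) (rule pres_cong.sym)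
  show "Relation.trans (pres_cong A R)"
    by (rule transI) (rule pres_cong.trans)
qed

lemma presented_mult:
  assumes "u \<in> nonempty_words A" "v \<in> nonempty_words A"
  shows "(pres_cong A R `` {u}) \<cdot>\<^bsub>presented_sgrp A R\<^esub> (pres_cong A R `` {v})
         = pres_cong A R `` {u @ v}"
proof -
  have "pres_cong A R `` {x @ y} = pres_cong A R `` {u @ v}"
    if "(u, x) \<in> pres_cong A R" "(v, y) \<in> pres_cong A R" for x y
    using equiv_class_eq[OF equiv_pres_cong pres_cong.append[OF that]] by simp
  moreover have "(u, u) \<in> pres_cong A R" "(v, v) \<in> pres_cong A R"
    using assms by (auto intro: pres_cong.refl)
  ultimately have "(\<Union>x\<in>pres_cong A R `` {u}. \<Union>y\<in>pres_cong A R `` {v}. pres_cong A R `` {x @ y})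
      = pres_cong A R `` {u @ v}"
    by blast
  then show ?thesis
    by (simp add: presented_sgrp_def)
qed

lemma sgrp_presented: "sgrp (presented_sgrp A R)"
proof
  let ?S = "presented_sgrp A R"
  have carr: "carrier ?S = nonempty_words A // pres_cong A R"
    by (simp add: presented_sgrp_def)
  fix x y assume "x \<in> carrier ?S" "y \<in> carrier ?S"
  then obtain u v where uv: "u \<in> nonempty_words A" "v \<in> nonempty_words A"
    and x: "x = pres_cong A R `` {u}" and y: "y = pres_cong A R `` {v}"
    unfolding carr by (auto elim!: quotientE)
  have uv': "u @ v \<in> nonempty_words A" using uv by auto
  show "x \<cdot>\<^bsub>?S\<^esub> y \<in> carrier ?S"
    unfolding x y presented_mult[OF uv] unfolding carr by (rule quotientI[OF uv'])
  fix z assume "z \<in> carrier ?S"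
  then obtain w where w: "w \<in> nonempty_words A" and z: "z = pres_cong A R `` {w}"
    unfolding carr by (auto elim!: quotientE)
  have vw: "v @ w \<in> nonempty_words A" using uv w by auto
  show "(x \<cdot>\<^bsub>?S\<^esub> y) \<cdot>\<^bsub>?S\<^esub> z = x \<cdot>\<^bsub>?S\<^esub> (y \<cdot>\<^bsub>?S\<^esub> z)"
    by (simp only: x y z presented_mult uv w uv' vw append_assoc)
qed


section \<open>The free idempotent generated semigroup over a biordered set\<close>

definition IG_relations :: "'a partial_algebra \<Rightarrow> ('a list \<times> 'a list) set" where
  "IG_relations \<E> = {([e, f], [g]) | e f g. pmult \<E> e f = Some g}"

definition IG :: "'a partial_algebra \<Rightarrow> 'a list set sgrp" where
  "IG \<E> = presented_sgrp (carrier \<E>) (IG_relations \<E>)"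

text \<open>The element of \<open>IG \<E>\<close> represented by a word. The empty word gets the value \<open>{}\<close>, which is
  not in the carrier of \<open>IG \<E>\<close> (\<open>IG_word_in_carrier\<close>), so it is neither regular nor related to
  anything by Green's relations.\<close>

definition IG_word :: "'a partial_algebra \<Rightarrow> 'a list \<Rightarrow> 'a list set" where
  "IG_word \<E> w = pres_cong (carrier \<E>) (IG_relations \<E>) `` {w}"

lemma IG_word_in_carrier:
  "IG_word \<E> w \<in> carrier (IG \<E>) \<longleftrightarrow> w \<in> lists (carrier \<E>) \<and> w \<noteq> []"
proof
  assume "IG_word \<E> w \<in> carrier (IG \<E>)"
  then have "IG_word \<E> w \<noteq> {}"
    using in_quotient_imp_non_empty[OF equiv_pres_cong]
    by (fastforce simp: IG_def presented_sgrp_def)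
  then show "w \<in> lists (carrier \<E>) \<and> w \<noteq> []"
    using pres_cong_words by (fastforce simp: IG_word_def)
next
  assume "w \<in> lists (carrier \<E>) \<and> w \<noteq> []"
  then show "IG_word \<E> w \<in> carrier (IG \<E>)"
    by (auto simp: IG_def presented_sgrp_def IG_word_def intro: quotientI)
qed

end

(* Regularity is detected by pumping.  If w = w w' w and p = w w', then w = p^n w for every n, so a
   derivation leads from w to the word p^n w.  Assign to each letter of a word in this derivation
   an ancestor, a letter of w: when e is split as f g, both factors have the ancestor of e; when
   e f is merged to g, then g R e or g L f, and g inherits the ancestor of e or f accordingly.  A
   factor A of U A V descending from the letter e of w = u e v then satisfies e = x A y,
   e v = x A V and u e = U A y for some x and y.  For n larger than the length of w, two of the
   copies of p start with letters of the same ancestor e, so A can be taken to be a nonempty power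
   of p.  Since p is idempotent and p w = w, this gives u e = p y, e v = x w and e = x p y, so
   e = x u e and e = e v w' y. *)

theory Submission
  imports Defs
begin

section \<open>Equality of words in the free idempotent generated semigroup\<close>

text \<open>One application of a defining relation in either direction. Rewriting one place at a
  time lets the letters of a word be followed through a derivation, which the closure rules of the
  presentation congruence do not show directly.\<close>

definition IG_step :: "'a partial_algebra \<Rightarrow> 'a list \<Rightarrow> 'a list \<Rightarrow> bool" where
  "IG_step \<E> s t \<longleftrightarrow> (\<exists>a b e f g. pmult \<E> e f = Some g \<and>
     (s = a @ [e, f] @ b \<and> t = a @ [g] @ b \<or> s = a @ [g] @ b \<and> t = a @ [e, f] @ b))"

text \<open>Unlike the congruence of the presentation, this relation is reflexive on the empty word
  too, so empty factors and contexts need no separate treatment.\<close>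

definition IG_eq :: "'a partial_algebra \<Rightarrow> 'a list \<Rightarrow> 'a list \<Rightarrow> bool" where
  "IG_eq \<E> = (IG_step \<E>)\<^sup>*\<^sup>*"

lemma IG_step_sym: "IG_step \<E> s t \<Longrightarrow> IG_step \<E> t s"
  unfolding IG_step_def by blast

lemma IG_step_context: "IG_step \<E> s t \<Longrightarrow> IG_step \<E> (a @ s @ b) (a @ t @ b)"
proof -
  assume "IG_step \<E> s t"
  then obtain c d e f g where "pmult \<E> e f = Some g"
    and "s = c @ [e, f] @ d \<and> t = c @ [g] @ d \<or> s = c @ [g] @ d \<and> t = c @ [e, f] @ d"
    unfolding IG_step_def by blast
  moreover from this(2) have
    "a @ s @ b = (a @ c) @ [e, f] @ (d @ b) \<and> a @ t @ b = (a @ c) @ [g] @ (d @ b) \<or>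
     a @ s @ b = (a @ c) @ [g] @ (d @ b) \<and> a @ t @ b = (a @ c) @ [e, f] @ (d @ b)"
    by auto
  ultimately show "IG_step \<E> (a @ s @ b) (a @ t @ b)"
    unfolding IG_step_def by blast
qed

lemma IG_eq_refl [simp]: "IG_eq \<E> s s"
  by (simp add: IG_eq_def)

lemma IG_eq_sym: "IG_eq \<E> s t \<Longrightarrow> IG_eq \<E> t s"
  unfolding IG_eq_def by (metis IG_step_sym sympI symp_rtranclp sympD)

lemma IG_eq_trans [trans]: "IG_eq \<E> s t \<Longrightarrow> IG_eq \<E> t u \<Longrightarrow> IG_eq \<E> s u"
  by (simp add: IG_eq_def)

lemma IG_eq_context: "IG_eq \<E> s t \<Longrightarrow> IG_eq \<E> (a @ s @ b) (a @ t @ b)"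
  unfolding IG_eq_def
proof (induction rule: rtranclp_induct)
  case (step t u)
  then show ?case
    by (meson IG_step_context rtranclp.rtrancl_into_rtrancl)
qed simp

lemma IG_eq_append: "IG_eq \<E> s s' \<Longrightarrow> IG_eq \<E> t t' \<Longrightarrow> IG_eq \<E> (s @ t) (s' @ t')"
  using IG_eq_context[of \<E> s s' "[]" t] IG_eq_context[of \<E> t t' s' "[]"]
  by (auto intro: IG_eq_trans)

lemma IG_eq_mult: "pmult \<E> e f = Some g \<Longrightarrow> IG_eq \<E> [e, f] [g]"
  unfolding IG_eq_def IG_step_def by (rule r_into_rtranclp) fastforce


section \<open>Basic products\<close>

text \<open>Of the four ways to be a basic pair, \<open>e f = e\<close> and \<open>f e = e\<close>
  give \<open>g e = e\<close>, while \<open>e f = f\<close> and \<open>f e = f\<close> give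
  \<open>f g = f\<close>. In every case \<open>g\<close> is idempotent, so these products are again
  basic and are available as relations of IG(\<E>).\<close>

lemma basic_product:
  assumes "biordered_set \<E>" "pmult \<E> e f = Some g"
  shows "e \<in> carrier \<E>" "f \<in> carrier \<E>" "g \<in> carrier \<E>"
    and "pmult \<E> g e = Some e \<or> pmult \<E> f g = Some f"
proof -
  obtain S :: "'a sgrp" where S: "sgrp S" and \<E>: "\<E> = biordered_set_of S"
    using assms(1) by (auto simp: biordered_set_def)
  interpret sgrp S by (rule S)
  have bp: "basic_pair S e f" and g: "g = e \<cdot>\<^bsub>S\<^esub> f"
    using assms(2) by (auto simp: \<E> biordered_set_of_def split: if_splits)
  have ce: "e \<in> carrier S" "e \<cdot>\<^bsub>S\<^esub> e = e" and cf: "f \<in> carrier S" "f \<cdot>\<^bsub>S\<^esub> f = f"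
    using bp by (auto simp: basic_pair_def idempotents_def)
  have gc: "g \<in> carrier S" using ce cf g mult_closed by simp
  consider "e \<cdot>\<^bsub>S\<^esub> f = e" | "e \<cdot>\<^bsub>S\<^esub> f = f" | "f \<cdot>\<^bsub>S\<^esub> e = e" | "f \<cdot>\<^bsub>S\<^esub> e = f"
    using bp by (auto simp: basic_pair_def)
  then have *: "g \<cdot>\<^bsub>S\<^esub> g = g \<and> (g \<cdot>\<^bsub>S\<^esub> e = e \<or> f \<cdot>\<^bsub>S\<^esub> g = f)"
    by cases (metis ce cf g gc mult_assoc)+
  have id: "e \<in> idempotents S" "f \<in> idempotents S" "g \<in> idempotents S"
    using * ce cf gc by (auto simp: idempotents_def)
  then show "e \<in> carrier \<E>" "f \<in> carrier \<E>" "g \<in> carrier \<E>"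
    by (simp_all add: \<E> biordered_set_of_def)
  show "pmult \<E> g e = Some e \<or> pmult \<E> f g = Some f"
    using * id by (auto simp: \<E> biordered_set_of_def basic_pair_def)
qed

lemma IG_step_lists:
  assumes "biordered_set \<E>" "IG_step \<E> s t" "s \<in> lists (carrier \<E>)"
  shows "t \<in> lists (carrier \<E>)"
proof -
  obtain a b e f g where "pmult \<E> e f = Some g"
    and "s = a @ [e, f] @ b \<and> t = a @ [g] @ b \<or> s = a @ [g] @ b \<and> t = a @ [e, f] @ b"
    using assms(2) unfolding IG_step_def by blast
  then show ?thesis using assms(3) basic_product(1-3)[OF assms(1)] by auto
qed

lemma IG_eq_lists:
  assumes "biordered_set \<E>" "IG_eq \<E> s t" "s \<in> lists (carrier \<E>)"
  shows "t \<in> lists (carrier \<E>)"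
  using assms(2,3) unfolding IG_eq_def
  by (induction rule: rtranclp_induct) (auto dest: IG_step_lists[OF assms(1)])

section \<open>Agreement of rewriting with the congruence of the presentation\<close>

lemma pres_cong_imp_IG_eq:
  "(s, t) \<in> pres_cong (carrier \<E>) (IG_relations \<E>) \<Longrightarrow> IG_eq \<E> s t"
  by (induction rule: pres_cong.induct)
     (auto simp: IG_relations_def intro: IG_eq_mult IG_eq_sym IG_eq_trans IG_eq_append)

lemma IG_step_imp_pres_cong:
  assumes "biordered_set \<E>" "IG_step \<E> s t" "s \<in> nonempty_words (carrier \<E>)"
  shows "(s, t) \<in> pres_cong (carrier \<E>) (IG_relations \<E>)"
proof -
  let ?C = "pres_cong (carrier \<E>) (IG_relations \<E>)"
  \<comment> \<open>The congruence lives on nonempty words, so an empty context cannot be supplied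
    by reflexivity and is split off.\<close>
  have context1: "(u @ a, v @ a) \<in> ?C" "(a @ u, a @ v) \<in> ?C"
    if "(u, v) \<in> ?C" "a \<in> lists (carrier \<E>)" for u v a
    using that by (cases "a = []"; force intro: pres_cong.append pres_cong.refl)+
  obtain a b e f g where m: "pmult \<E> e f = Some g"
    and st: "s = a @ [e, f] @ b \<and> t = a @ [g] @ b \<or> s = a @ [g] @ b \<and> t = a @ [e, f] @ b"
    using assms(2) unfolding IG_step_def by blast
  have "([e, f], [g]) \<in> ?C"
    using m basic_product(1-3)[OF assms(1) m]
    by (intro pres_cong.rel) (auto simp: IG_relations_def)
  moreover have "a \<in> lists (carrier \<E>)" "b \<in> lists (carrier \<E>)"
    using st assms(3) by auto
  ultimately have "(a @ [e, f] @ b, a @ [g] @ b) \<in> ?C"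
    by (intro context1)
  then show ?thesis using st pres_cong.sym by metis
qed

lemma pres_cong_iff_IG_eq:
  assumes "biordered_set \<E>" "s \<in> nonempty_words (carrier \<E>)"
  shows "(s, t) \<in> pres_cong (carrier \<E>) (IG_relations \<E>) \<longleftrightarrow> IG_eq \<E> s t"
proof
  assume "IG_eq \<E> s t"
  then show "(s, t) \<in> pres_cong (carrier \<E>) (IG_relations \<E>)"
    unfolding IG_eq_def
  proof (induction rule: rtranclp_induct)
    case base
    show ?case using assms(2) by (rule pres_cong.refl)
  next
    case (step t u)
    then show ?case
      using IG_step_imp_pres_cong[OF assms(1)] pres_cong_words by (blast intro: pres_cong.trans)
  qed
qed (rule pres_cong_imp_IG_eq)


section \<open>Tracing letters through a derivation\<close>

text \<open>The relation between a letter \<open>w ! i\<close> and a factor \<open>a\<close> of \<open>u @ a @ v\<close> all of whose letters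
  descend from it.  The same \<open>x\<close> and \<open>y\<close> have to serve in all three equations.\<close>

definition descends :: "'a partial_algebra \<Rightarrow> 'a list \<Rightarrow> nat \<Rightarrow> 'a list \<Rightarrow> 'a list \<Rightarrow> 'a list \<Rightarrow> bool"
  where "descends \<E> w i u a v \<longleftrightarrow> i < length w \<and> (\<exists>x y.
     IG_eq \<E> [w ! i] (x @ a @ y) \<and>
     IG_eq \<E> (drop i w) (x @ a @ v) \<and>
     IG_eq \<E> (take (Suc i) w) (u @ a @ y))"

lemma descends_cong:
  assumes "descends \<E> w i u a v" "IG_eq \<E> u u'" "IG_eq \<E> a a'" "IG_eq \<E> v v'"
  shows "descends \<E> w i u' a' v'"
  using assms unfolding descends_def by (meson IG_eq_append IG_eq_refl IG_eq_trans)

text \<open>The discarded part \<open>b\<close> is absorbed into \<open>y\<close>, which becomes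
  \<open>b @ y\<close>.\<close>

lemma descends_drop_right:
  assumes "descends \<E> w i u (a @ b) v"
  shows "descends \<E> w i u a (b @ v)"
proof -
  obtain x y where "i < length w" "IG_eq \<E> [w ! i] (x @ a @ (b @ y))"
    "IG_eq \<E> (drop i w) (x @ a @ (b @ v))" "IG_eq \<E> (take (Suc i) w) (u @ a @ (b @ y))"
    using assms unfolding descends_def by auto
  then show ?thesis unfolding descends_def by blast
qed

lemma descends_drop_left:
  assumes "descends \<E> w i u (b @ a) v"
  shows "descends \<E> w i (u @ b) a v"
proof -
  obtain x y where "i < length w" "IG_eq \<E> [w ! i] ((x @ b) @ a @ y)"
    "IG_eq \<E> (drop i w) ((x @ b) @ a @ v)" "IG_eq \<E> (take (Suc i) w) ((u @ b) @ a @ y)"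
    using assms unfolding descends_def by auto
  then show ?thesis unfolding descends_def by blast
qed

text \<open>The factor ends in \<open>e\<close>, and \<open>f\<close> lies just outside it. Since
  \<open>e = g e\<close>, the new witness for \<open>y\<close> is \<open>e # y\<close>; the equation
  involving \<open>v\<close> follows from \<open>e f = g\<close> instead.\<close>

lemma descends_merge_right:
  assumes "descends \<E> w i u (a @ [e]) (f # v)" "IG_eq \<E> [e, f] [g]" "IG_eq \<E> [g, e] [e]"
  shows "descends \<E> w i u (a @ [g]) v"
proof -
  obtain x y where *: "i < length w" "IG_eq \<E> [w ! i] ((x @ a) @ [e] @ y)"
    "IG_eq \<E> (drop i w) ((x @ a) @ [e, f] @ v)" "IG_eq \<E> (take (Suc i) w) ((u @ a) @ [e] @ y)"
    using assms(1) unfolding descends_def by auto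
  have "IG_eq \<E> (c @ [e] @ y) (c @ [g, e] @ y)" for c
    using IG_eq_context[OF IG_eq_sym[OF assms(3)], of c y] by simp
  moreover have "IG_eq \<E> ((x @ a) @ [e, f] @ v) ((x @ a) @ [g] @ v)"
    using assms(2) by (rule IG_eq_context)
  ultimately have "IG_eq \<E> [w ! i] ((x @ a) @ [g, e] @ y)"
    "IG_eq \<E> (drop i w) ((x @ a) @ [g] @ v)" "IG_eq \<E> (take (Suc i) w) ((u @ a) @ [g, e] @ y)"
    using * IG_eq_trans by metis+
  then have "IG_eq \<E> [w ! i] (x @ (a @ [g]) @ (e # y))" "IG_eq \<E> (drop i w) (x @ (a @ [g]) @ v)"
    "IG_eq \<E> (take (Suc i) w) (u @ (a @ [g]) @ (e # y))" by simp_all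
  then show ?thesis unfolding descends_def using *(1) by blast
qed

text \<open>The mirror image: \<open>f = f g\<close> turns \<open>x\<close> into
  \<open>x @ [f]\<close>, and \<open>e f = g\<close> settles the equation involving
  \<open>u\<close>.\<close>

lemma descends_merge_left:
  assumes "descends \<E> w i (u @ [e]) (f # a) v" "IG_eq \<E> [e, f] [g]" "IG_eq \<E> [f, g] [f]"
  shows "descends \<E> w i u (g # a) v"
proof -
  obtain x y where *: "i < length w" "IG_eq \<E> [w ! i] (x @ [f] @ (a @ y))"
    "IG_eq \<E> (drop i w) (x @ [f] @ (a @ v))" "IG_eq \<E> (take (Suc i) w) (u @ [e, f] @ (a @ y))"
    using assms(1) unfolding descends_def by auto
  have "IG_eq \<E> (x @ [f] @ c) (x @ [f, g] @ c)" for c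
    using IG_eq_context[OF IG_eq_sym[OF assms(3)], of x c] by simp
  moreover have "IG_eq \<E> (u @ [e, f] @ (a @ y)) (u @ [g] @ (a @ y))"
    using assms(2) by (rule IG_eq_context)
  ultimately have "IG_eq \<E> [w ! i] (x @ [f, g] @ (a @ y))"
    "IG_eq \<E> (drop i w) (x @ [f, g] @ (a @ v))" "IG_eq \<E> (take (Suc i) w) (u @ [g] @ (a @ y))"
    using * IG_eq_trans by metis+
  then have "IG_eq \<E> [w ! i] ((x @ [f]) @ (g # a) @ y)" "IG_eq \<E> (drop i w) ((x @ [f]) @ (g # a) @ v)"
    "IG_eq \<E> (take (Suc i) w) (u @ (g # a) @ y)" by simp_all
  then show ?thesis unfolding descends_def using *(1) by blast
qed

text \<open>Each letter of \<open>T\<close> carries the position in \<open>w\<close> of its ancestor.\<close>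

definition traced :: "'a partial_algebra \<Rightarrow> 'a list \<Rightarrow> ('a \<times> nat) list \<Rightarrow> bool" where
  "traced \<E> w T \<longleftrightarrow> sorted (map snd T) \<and> (\<forall>U A V i. T = U @ A @ V \<and> A \<noteq> [] \<and> snd ` set A \<subseteq> {i}
     \<longrightarrow> descends \<E> w i (map fst U) (map fst A) (map fst V))"

lemma tracedD:
  "traced \<E> w (U @ A @ V) \<Longrightarrow> A \<noteq> [] \<Longrightarrow> snd ` set A \<subseteq> {i}
     \<Longrightarrow> descends \<E> w i (map fst U) (map fst A) (map fst V)"
  unfolding traced_def by blast

text \<open>Every letter is its own ancestor. The labels are distinct, so a nonempty factor with
  constant label is a single letter, and empty \<open>x\<close> and \<open>y\<close> serve.\<close>

lemma traced_initial: "traced \<E> w (zip w [0..<length w])"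
  unfolding traced_def
proof (intro conjI allI impI)
  show "sorted (map snd (zip w [0..<length w]))" by simp
  fix U A V i
  assume *: "zip w [0..<length w] = U @ A @ V \<and> A \<noteq> [] \<and> snd ` set A \<subseteq> {i}"
  have snds: "map snd U @ map snd A @ map snd V = [0..<length w]"
    and fsts: "w = map fst U @ map fst A @ map fst V"
    using * by (metis map_append map_snd_zip length_upt diff_zero)
      (use * in \<open>metis map_append map_fst_zip length_upt diff_zero\<close>)
  have "distinct (map snd A)"
    using snds by (metis distinct_append distinct_upt)
  moreover have "set (map snd A) \<subseteq> {i}" using * by simp
  ultimately have "length A \<le> 1"
    by (metis card_mono distinct_card finite.emptyI finite.insertI is_singletonI
        is_singleton_altdef length_map)
  then obtain c where A: "A = [(c, i)]"
    using * by (cases A) auto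
  have "[0..<length w] ! length U = i"
    unfolding snds[symmetric] A by (simp add: nth_append)
  moreover have "length U < length w"
    using fsts A by (metis length_map length_append add_less_cancel_left less_add_same_cancel1
        length_greater_0_conv add_pos_nonneg zero_le list.simps(3) map_is_Nil_conv)
  ultimately have "length U = i" by simp
  then show "descends \<E> w i (map fst U) (map fst A) (map fst V)"
    unfolding descends_def
    by (intro conjI exI[of _ "[]"]) (simp_all add: fsts A nth_append)
qed

text \<open>Locates the rewritten letter \<open>z\<close> relative to the factor \<open>A\<close>:
  before it, inside it or after it.\<close>

lemma append_Cons_eq_append3_cases:
  assumes "P @ z # Q = U @ A @ V"
  obtains (left) U' where "U = P @ z # U'" "Q = U' @ A @ V"
  | (middle) A1 A2 where "P = U @ A1" "A = A1 @ z # A2" "Q = A2 @ V"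
  | (right) V' where "P = U @ A @ V'" "V = V' @ z # Q"
  using assms that
  by (auto simp: append_eq_append_conv2 Cons_eq_append_conv append_eq_Cons_conv)

text \<open>If \<open>A\<close> contains both or neither of the new letters, the claim is the old
  one up to equality of words. If the boundary of \<open>A\<close> separates \<open>e\<close> from
  \<open>f\<close>, the factor is first enlarged to contain both; its label stays constant because
  they share \<open>k\<close>. The extra letter is then dropped.\<close>

lemma traced_split:
  assumes "traced \<E> w (P @ (g, k) # Q)" and m: "pmult \<E> e f = Some g"
  shows "traced \<E> w (P @ (e, k) # (f, k) # Q)"
  unfolding traced_def
proof (intro conjI allI impI)
  show "sorted (map snd (P @ (e, k) # (f, k) # Q))"
    using assms(1) by (auto simp: traced_def sorted_append)
  fix U A V i
  assume "P @ (e, k) # (f, k) # Q = U @ A @ V \<and> A \<noteq> [] \<and> snd ` set A \<subseteq> {i}"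
  then have eq: "P @ (e, k) # (f, k) # Q = U @ A @ V" and A: "A \<noteq> []" "snd ` set A \<subseteq> {i}"
    by auto
  have sp: "IG_eq \<E> (a @ g # b) (a @ e # f # b)" for a b
    using IG_eq_context[OF IG_eq_sym[OF IG_eq_mult[OF m]], of a b] by simp
  have old: "descends \<E> w i (map fst U') (map fst A') (map fst V')"
    if "P @ (g, k) # Q = U' @ A' @ V'" "A' \<noteq> []" "snd ` set A' \<subseteq> {i}" for U' A' V'
    using that assms(1) tracedD by metis
  from eq show "descends \<E> w i (map fst U) (map fst A) (map fst V)"
  proof (cases rule: append_Cons_eq_append3_cases)
    case (left U')
    show ?thesis
    proof (cases U')
      case Nil
      then obtain A' where A': "A = (f, k) # A'" "Q = A' @ V" using left A by (cases A) auto
      have "descends \<E> w i (map fst P) (g # map fst A') (map fst V)"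
        using old[of P "(g, k) # A'" V] A A' by simp
      then have "descends \<E> w i (map fst P) ([e] @ f # map fst A') (map fst V)"
        by (rule descends_cong) (use sp[of "[]"] in simp_all)
      then show ?thesis using descends_drop_left left Nil A' by fastforce
    next
      case (Cons z U'')
      then have U: "U = P @ (e, k) # (f, k) # U''" "Q = U'' @ A @ V" using left by auto
      have "descends \<E> w i (map fst P @ g # map fst U'') (map fst A) (map fst V)"
        using old[of "P @ (g, k) # U''" A V] A U by simp
      then show ?thesis
        by (rule descends_cong) (use sp U in simp_all)
    qed
  next
    case (middle A1 A2)
    show ?thesis
    \<comment> \<open>Here \<open>e\<close> lies in \<open>A\<close>; an empty \<open>A2\<close>
      means that \<open>A\<close> ends with \<open>e\<close> and that \<open>f\<close> is the first
      letter of \<open>V\<close>.\<close>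
    proof (cases A2)
      case Nil
      then have V: "V = (f, k) # Q" using middle by simp
      have "descends \<E> w i (map fst U) (map fst A1 @ [g]) (map fst Q)"
        using old[of U "A1 @ [(g, k)]" Q] A middle Nil by simp
      then have "descends \<E> w i (map fst U) ((map fst A1 @ [e]) @ [f]) (map fst Q)"
        by (rule descends_cong) (use sp[of "map fst A1" "[]"] in simp_all)
      then show ?thesis using descends_drop_right middle Nil V by fastforce
    next
      case (Cons z A3)
      then have A3: "A = A1 @ (e, k) # (f, k) # A3" "Q = A3 @ V" using middle by auto
      have "descends \<E> w i (map fst U) (map fst A1 @ g # map fst A3) (map fst V)"
        using old[of U "A1 @ (g, k) # A3" V] A A3 middle by simp
      then show ?thesis
        by (rule descends_cong) (use sp A3 in simp_all)
    qed
  next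
    case (right V')
    have "descends \<E> w i (map fst U) (map fst A) (map fst V' @ g # map fst Q)"
      using old[of U A "V' @ (g, k) # Q"] A right by simp
    then show ?thesis
      by (rule descends_cong) (use sp right in simp_all)
  qed
qed

text \<open>A product \<open>g = e * f\<close> is \<open>\<R>\<close>-related to \<open>e\<close> or \<open>\<L>\<close>-related to \<open>f\<close>; it inherits its ancestor
  from that factor.\<close>

lemma traced_merge:
  assumes bio: "biordered_set \<E>" and tr: "traced \<E> w (P @ (e, j) # (f, k) # Q)"
    and m: "pmult \<E> e f = Some g"
  shows "\<exists>l. traced \<E> w (P @ (g, l) # Q)"
proof -
  have sorted: "sorted (map snd (P @ (e, j) # (f, k) # Q))"
    using tr by (simp add: traced_def)
  have ef: "IG_eq \<E> [e, f] [g]" using m by (rule IG_eq_mult)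
  have mg: "IG_eq \<E> (a @ e # f # b) (a @ g # b)" for a b
    using IG_eq_context[OF ef, of a b] by simp
  have old: "descends \<E> w i (map fst U') (map fst A') (map fst V')"
    if "P @ (e, j) # (f, k) # Q = U' @ A' @ V'" "A' \<noteq> []" "snd ` set A' \<subseteq> {i}" for i U' A' V'
    using that tr tracedD by metis
  \<comment> \<open>If both factors could pass on their ancestor, that of \<open>e\<close> is taken.
    The labels stay sorted either way, since \<open>l\<close> is \<open>j\<close> or
    \<open>k\<close>.\<close>
  define l where "l = (if pmult \<E> g e = Some e then j else k)"
  have "traced \<E> w (P @ (g, l) # Q)"
    unfolding traced_def
  proof (intro conjI allI impI)
    show "sorted (map snd (P @ (g, l) # Q))"
      using sorted by (auto simp: sorted_append l_def)
    fix U A V i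
    assume "P @ (g, l) # Q = U @ A @ V \<and> A \<noteq> [] \<and> snd ` set A \<subseteq> {i}"
    then have eq: "P @ (g, l) # Q = U @ A @ V" and A: "A \<noteq> []" "snd ` set A \<subseteq> {i}"
      by auto
    from eq show "descends \<E> w i (map fst U) (map fst A) (map fst V)"
    proof (cases rule: append_Cons_eq_append3_cases)
      case (left U')
      have "descends \<E> w i (map fst P @ e # f # map fst U') (map fst A) (map fst V)"
        using old[of "P @ (e, j) # (f, k) # U'" A V] A left by simp
      then show ?thesis
        by (rule descends_cong) (use mg left in simp_all)
    next
      case (right V')
      have "descends \<E> w i (map fst U) (map fst A) (map fst V' @ e # f # map fst Q)"
        using old[of U A "V' @ (e, j) # (f, k) # Q"] A right by simp
      then show ?thesis
        by (rule descends_cong) (use mg right in simp_all)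
    next
      case (middle A1 A2)
      have l: "l = i" using A middle by auto
      \<comment> \<open>With equal labels on \<open>e\<close> and \<open>f\<close>, the old factor
        may contain both, and merging is a mere equality of words.\<close>
      have inner: ?thesis if "j = i" "k = i"
      proof -
        have "descends \<E> w i (map fst U) (map fst A1 @ e # f # map fst A2) (map fst V)"
          using old[of U "A1 @ (e, j) # (f, k) # A2" V] A middle that by simp
        then show ?thesis
          by (rule descends_cong) (use mg middle in simp_all)
      qed
      show ?thesis
      proof (cases "pmult \<E> g e = Some e")
        case True
        then have j: "j = i" using l l_def by simp
        show ?thesis
        proof (cases "A2 = []")
          case A2: True
          have "descends \<E> w i (map fst U) (map fst A1 @ [e]) (f # map fst Q)"
            using old[of U "A1 @ [(e, j)]" "(f, k) # Q" i] A middle j A2 by simp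
          from descends_merge_right[OF this ef IG_eq_mult[OF True]]
          show ?thesis using middle A2 by simp
        next
          case False
          then obtain z A3 where "A2 = z # A3" by (cases A2) auto
          \<comment> \<open>Sortedness squeezes \<open>k\<close> between \<open>j = i\<close> and
            the label \<open>i\<close> of \<open>z\<close>, which lies in \<open>A\<close> to the
            right.\<close>
          then have "k = i"
            using sorted j A middle by (auto simp: sorted_append)
          with j show ?thesis by (rule inner)
        qed
      next
        case False
        then have k: "k = i" using l l_def by simp
        have fg: "pmult \<E> f g = Some f" using basic_product(4)[OF bio m] False by blast
        show ?thesis
        proof (cases "A1 = []")
          case A1: True
          have "descends \<E> w i (map fst P @ [e]) (f # map fst A2) (map fst V)"
            using old[of "P @ [(e, j)]" "(f, k) # A2" V i] A middle k A1 by simp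
          from descends_merge_left[OF this ef IG_eq_mult[OF fg]]
          show ?thesis using middle A1 by simp
        next
          case False
          then obtain z A3 where "A1 = z # A3" by (cases A1) auto
          \<comment> \<open>Dually, \<open>j\<close> is squeezed between the label \<open>i\<close>
            of \<open>z\<close> and \<open>k = i\<close>.\<close>
          then have "j = i"
            using sorted k A middle by (auto simp: sorted_append)
          then show ?thesis using k by (rule inner)
        qed
      qed
    qed
  qed
  then show ?thesis by blast
qed

lemma IG_eq_traced:
  assumes "biordered_set \<E>" "IG_eq \<E> w t"
  shows "\<exists>T. map fst T = t \<and> traced \<E> w T"
  using assms(2) unfolding IG_eq_def
proof (induction rule: rtranclp_induct)
  case base
  show ?case using traced_initial by (metis map_fst_zip length_upt diff_zero)
next
  case (step s t)
  then obtain T where T: "map fst T = s" "traced \<E> w T" by blast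
  obtain a b e f g where m: "pmult \<E> e f = Some g"
    and "s = a @ [e, f] @ b \<and> t = a @ [g] @ b \<or> s = a @ [g] @ b \<and> t = a @ [e, f] @ b"
    using step(2) unfolding IG_step_def by blast
  then consider "s = a @ [e, f] @ b" "t = a @ [g] @ b" | "s = a @ [g] @ b" "t = a @ [e, f] @ b"
    by blast
  then show ?case
  proof cases
    case 1
    then obtain P j k Q where "T = P @ (e, j) # (f, k) # Q" "map fst P = a" "map fst Q = b"
      using T(1) by (auto simp: map_eq_append_conv map_eq_Cons_conv)
    moreover from this(1) obtain l where "traced \<E> w (P @ (g, l) # Q)"
      using traced_merge[OF assms(1) _ m] T(2) by blast
    ultimately show ?thesis using 1 by (intro exI[of _ "P @ (g, l) # Q"]) simp
  next
    case 2
    then obtain P k Q where "T = P @ (g, k) # Q" "map fst P = a" "map fst Q = b"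
      using T(1) by (auto simp: map_eq_append_conv map_eq_Cons_conv)
    moreover from this(1) have "traced \<E> w (P @ (e, k) # (f, k) # Q)"
      using traced_split[OF _ m] T(2) by blast
    ultimately show ?thesis using 2 by (intro exI[of _ "P @ (e, k) # (f, k) # Q"]) simp
  qed
qed


section \<open>Pumping\<close>

lemma IG_eq_power_idempotent:
  assumes "IG_eq \<E> (p @ p) p"
  shows "IG_eq \<E> (concat (replicate (Suc n) p)) p"
proof (induction n)
  case (Suc n)
  have "IG_eq \<E> (p @ concat (replicate (Suc n) p)) (p @ p)"
    using Suc by (intro IG_eq_append) simp_all
  then show ?case using assms IG_eq_trans by fastforce
qed simp

lemma IG_eq_power_absorb:
  assumes "IG_eq \<E> (p @ w) w"
  shows "IG_eq \<E> (concat (replicate n p) @ w) w"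
proof (induction n)
  case (Suc n)
  have "IG_eq \<E> (p @ concat (replicate n p) @ w) (p @ w)"
    using Suc by (intro IG_eq_append) simp_all
  then show ?case using assms IG_eq_trans by fastforce
qed simp

text \<open>Pigeonhole on \<open>length w + 1\<close> copies of \<open>p\<close> in front of
  \<open>w\<close>: labels are positions in \<open>w\<close>, so two copies begin with the same
  label, and sortedness extends it to everything between.\<close>

lemma pumped_descendant:
  assumes bio: "biordered_set \<E>" and pw: "IG_eq \<E> (p @ w) w" and "p \<noteq> []"
  shows "\<exists>i k m n. descends \<E> w i (concat (replicate k p)) (concat (replicate (Suc m) p))
           (concat (replicate n p) @ w)"
proof -
  let ?pow = "\<lambda>n. concat (replicate n p)"
  let ?N = "length w"
  have len: "length (?pow n) = n * length p" for n by (induction n) auto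
  have pow_add: "?pow (m + n) = ?pow m @ ?pow n" for m n
    by (simp add: replicate_add)
  have "IG_eq \<E> w (?pow (Suc ?N) @ w)"
    using IG_eq_power_absorb[OF pw] by (rule IG_eq_sym)
  then obtain T where T: "map fst T = ?pow (Suc ?N) @ w" and tr: "traced \<E> w T"
    using IG_eq_traced[OF bio] by blast
  have lT: "length T = Suc ?N * length p + ?N"
    using arg_cong[OF T, of length] len[of "Suc ?N"] by (simp del: replicate_Suc)
  have p0: "length p > 0" using assms(3) by simp
  \<comment> \<open>The label of the first letter of copy \<open>n\<close>, with copies numbered
    from 0 to \<open>?N\<close>.\<close>
  define lab where "lab n = snd (T ! (n * length p))" for n
  have inT: "n * length p < length T" if "n \<le> ?N" for n
  proof -
    have "n * length p \<le> ?N * length p" using that by (rule mult_le_mono1)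
    then show ?thesis using p0 unfolding lT mult_Suc by linarith
  qed
  \<comment> \<open>A one-letter factor descends from its label, and \<open>descends\<close>
    includes the bound on the position.\<close>
  have "lab n < ?N" if "n \<le> ?N" for n
  proof -
    let ?q = "n * length p"
    have "traced \<E> w (take ?q T @ [T ! ?q] @ drop (Suc ?q) T)"
      using tr id_take_nth_drop[OF inT[OF that]] by simp
    from tracedD[OF this, of "lab n"] show ?thesis
      by (simp add: lab_def descends_def)
  qed
  then have "lab ` {..?N} \<subseteq> {..<?N}" by auto
  then have "card (lab ` {..?N}) < card {..?N}"
    using card_mono[of "{..<?N}" "lab ` {..?N}"] by simp
  then have "\<not> inj_on lab {..?N}" by (rule pigeonhole)
  then obtain k k' where kk: "k < k'" "k' \<le> ?N" "lab k = lab k'"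
    unfolding inj_on_def by (metis atMost_iff linorder_neqE_nat)
  obtain m where m: "k' = k + Suc m"
    using kk(1) less_natE by (metis add_Suc_right)
  obtain n where n: "Suc ?N = k' + n" using kk(2) le_SucI le_Suc_ex by blast
  \<comment> \<open>\<open>A\<close> runs from the start of copy \<open>k\<close> to just before
    copy \<open>k'\<close>. It consists of \<open>Suc m\<close> copies and is therefore nonempty;
    \<open>n\<close> copies remain in front of \<open>w\<close>.\<close>
  define U where "U = take (k * length p) T"
  define A where "A = take (Suc m * length p) (drop (k * length p) T)"
  define V where "V = drop (k' * length p) T"
  have k'_len: "k' * length p = k * length p + Suc m * length p"
    by (simp add: m algebra_simps)
  have UAV: "T = U @ A @ V"
    unfolding U_def A_def V_def k'_len by (metis add.commute append_take_drop_id drop_drop)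
  have lU: "length U = k * length p" and lA: "length A = Suc m * length p"
    using inT[of k] inT[of k'] kk by (auto simp: U_def A_def k'_len)
  have "?pow (Suc ?N) = ?pow k @ ?pow (Suc m) @ ?pow n"
    unfolding n m by (simp only: pow_add append_assoc)
  then have eq: "map fst U @ map fst A @ map fst V = ?pow k @ ?pow (Suc m) @ (?pow n @ w)"
    using T unfolding UAV by (simp only: map_append append_assoc)
  have lens: "length (map fst U) = length (?pow k)" "length (map fst A) = length (?pow (Suc m))"
    by (simp_all only: len length_map lU lA)
  have U: "map fst U = ?pow k \<and> map fst A @ map fst V = ?pow (Suc m) @ (?pow n @ w)"
    by (rule iffD1[OF append_eq_append_conv[OF disjI1[OF lens(1)]] eq])
  have "map fst A = ?pow (Suc m) \<and> map fst V = ?pow n @ w"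
    by (rule iffD1[OF append_eq_append_conv[OF disjI1[OF lens(2)]] conjunct2[OF U]])
  with U have maps: "map fst U = ?pow k" "map fst A = ?pow (Suc m)" "map fst V = ?pow n @ w"
    by blast+
  \<comment> \<open>The label of \<open>z\<close> lies between those of the first letters of copies
    \<open>k\<close> and \<open>k'\<close>, which are equal. Copy \<open>k'\<close> exists because
    \<open>k'\<close> is at most \<open>?N\<close>.\<close>
  have "snd z = lab k" if zA: "z \<in> set A" for z
  proof -
    obtain q where q: "q < length A" "z = A ! q" using zA by (auto simp: in_set_conv_nth)
    then have z: "z = T ! (k * length p + q)"
      using UAV lU by (simp add: nth_append)
    have sorted: "sorted (map snd T)" using tr by (simp add: traced_def)
    have "k * length p + q < k' * length p" using q lA k'_len by simp
    moreover have "k' * length p < length T" using inT kk by blast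
    ultimately have "lab k \<le> snd z" "snd z \<le> lab k'"
      using sorted_nth_mono[OF sorted, of "k * length p" "k * length p + q"]
        sorted_nth_mono[OF sorted, of "k * length p + q" "k' * length p"]
      by (simp_all add: z lab_def)
    then show ?thesis using kk by simp
  qed
  then have "descends \<E> w (lab k) (map fst U) (map fst A) (map fst V)"
    using tr lA p0 by (intro tracedD) (auto simp: UAV[symmetric])
  then show ?thesis unfolding maps by blast
qed


section \<open>Regular words\<close>

text \<open>The factors \<open>u\<close>, \<open>v\<close> of the theorem, with the relations \<open>u e \<L> e \<R> e v\<close> spelled out.\<close>

definition seed :: "'a partial_algebra \<Rightarrow> 'a list \<Rightarrow> 'a \<Rightarrow> 'a list \<Rightarrow> bool" where
  "seed \<E> u e v \<longleftrightarrow> (\<exists>x. IG_eq \<E> [e] (x @ u @ [e])) \<and> (\<exists>y. IG_eq \<E> [e] ([e] @ v @ y))"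

lemma regular_imp_seed:
  assumes bio: "biordered_set \<E>" and reg: "IG_eq \<E> (w @ w' @ w) w" and "w \<noteq> []"
  shows "\<exists>u e v. w = u @ [e] @ v \<and> seed \<E> u e v"
proof -
  let ?p = "w @ w'"
  have pw: "IG_eq \<E> (?p @ w) w" using reg by simp
  have pp: "IG_eq \<E> (?p @ ?p) ?p"
    using IG_eq_context[OF pw, of "[]" w'] by simp
  obtain i k m n where "descends \<E> w i (concat (replicate k ?p)) (concat (replicate (Suc m) ?p))
           (concat (replicate n ?p) @ w)"
    using pumped_descendant[OF bio pw] assms(3) by blast
  \<comment> \<open>The factor and the tail collapse to \<open>p\<close> and \<open>w\<close>. The
    prefix is kept as a power because \<open>k\<close> may be 0; it is absorbed in
    \<open>uc'\<close>, where a further \<open>p\<close> follows it.\<close>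
  then have "descends \<E> w i (concat (replicate k ?p)) ?p w"
    by (rule descends_cong)
      (simp_all only: IG_eq_refl IG_eq_power_idempotent[OF pp] IG_eq_power_absorb[OF pw])
  then obtain x y where i: "i < length w"
    and c: "IG_eq \<E> [w ! i] (x @ ?p @ y)"
    and cv: "IG_eq \<E> (drop i w) (x @ ?p @ w)"
    and uc: "IG_eq \<E> (take (Suc i) w) (concat (replicate k ?p) @ ?p @ y)"
    unfolding descends_def by blast
  let ?u = "take i w" and ?e = "w ! i" and ?v = "drop (Suc i) w"
  have w: "w = ?u @ [?e] @ ?v" using id_take_nth_drop[OF i] by simp
  have uc': "IG_eq \<E> (?u @ [?e]) (?p @ y)"
  proof -
    have "concat (replicate k ?p) @ ?p = concat (replicate (Suc k) ?p)"
      by (metis concat.simps concat_append append_Nil2 replicate_append_same replicate_Suc)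
    then have "IG_eq \<E> ((concat (replicate k ?p) @ ?p) @ y) (?p @ y)"
      using IG_eq_append[OF IG_eq_power_idempotent[OF pp] IG_eq_refl] by metis
    then show ?thesis
      using uc i IG_eq_trans by (metis append_assoc take_Suc_conv_app_nth)
  qed
  have cv': "IG_eq \<E> ([?e] @ ?v) (x @ w)"
    using IG_eq_trans[OF cv IG_eq_append[OF IG_eq_refl pw]] i by (simp add: Cons_nth_drop_Suc)
  have "IG_eq \<E> [?e] (x @ ?u @ [?e])"
    using c IG_eq_append[OF IG_eq_refl IG_eq_sym[OF uc']] by (rule IG_eq_trans)
  moreover have "IG_eq \<E> (x @ ?p @ y) (([?e] @ ?v) @ w' @ y)"
    using IG_eq_append[OF IG_eq_sym[OF cv'] IG_eq_refl] by simp
  then have "IG_eq \<E> [?e] ([?e] @ ?v @ (w' @ y))"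
    using c IG_eq_trans by fastforce
  ultimately show ?thesis using w unfolding seed_def by blast
qed

text \<open>The inverse is \<open>y e x\<close>: inserting it between two copies of
  \<open>u e v\<close> gives \<open>u (e v y) e (x u e) v = u e e e v = u e v\<close>. The middle
  \<open>e\<close> keeps it nonempty when \<open>x\<close> and \<open>y\<close> are empty.\<close>

lemma seed_imp_regular:
  assumes "seed \<E> u e v" and ee: "IG_eq \<E> [e, e] [e]"
  shows "\<exists>w'. w' \<noteq> [] \<and> IG_eq \<E> ((u @ [e] @ v) @ w' @ (u @ [e] @ v)) (u @ [e] @ v)"
proof -
  obtain x y where x: "IG_eq \<E> (x @ u @ [e]) [e]" and y: "IG_eq \<E> ([e] @ v @ y) [e]"
    using assms unfolding seed_def by (metis IG_eq_sym)
  have "IG_eq \<E> (([e] @ v @ y) @ [e] @ (x @ u @ [e])) ([e] @ [e] @ [e])"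
    by (intro IG_eq_append x y IG_eq_refl)
  also have "IG_eq \<E> ([e] @ [e] @ [e]) ([e] @ [e])"
    using IG_eq_append[OF IG_eq_refl ee, of "[e]"] by simp
  also have "IG_eq \<E> ([e] @ [e]) [e]" using ee by simp
  finally have "IG_eq \<E> (u @ (([e] @ v @ y) @ [e] @ (x @ u @ [e])) @ v) (u @ [e] @ v)"
    by (rule IG_eq_context)
  then show ?thesis by (intro exI[of _ "y @ [e] @ x"]) simp
qed


section \<open>Green's relations of words\<close>

context
  fixes \<E> :: "'a partial_algebra"
  assumes bio: "biordered_set \<E>"
begin

lemma IG_word_eq_iff:
  assumes "s \<in> nonempty_words (carrier \<E>)" "t \<in> nonempty_words (carrier \<E>)"
  shows "IG_word \<E> s = IG_word \<E> t \<longleftrightarrow> IG_eq \<E> s t"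
  using eq_equiv_class_iff[OF equiv_pres_cong assms] pres_cong_iff_IG_eq[OF bio assms(1)]
  by (simp add: IG_word_def)

lemma IG_word_mult:
  assumes "s \<in> nonempty_words (carrier \<E>)" "t \<in> nonempty_words (carrier \<E>)"
  shows "IG_word \<E> s \<cdot>\<^bsub>IG \<E>\<^esub> IG_word \<E> t = IG_word \<E> (s @ t)"
  using presented_mult[OF assms] by (simp add: IG_def IG_word_def)

lemma carrier_IG: "carrier (IG \<E>) = IG_word \<E> ` nonempty_words (carrier \<E>)"
  by (auto simp: IG_def presented_sgrp_def IG_word_def quotient_def)

lemma idempotent_letter:
  assumes "e \<in> carrier \<E>"
  shows "IG_eq \<E> [e, e] [e]"
proof -
  have "pmult \<E> e e = Some e"
    using bio assms by (auto simp: biordered_set_def biordered_set_of_def basic_pair_def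
        idempotents_def)
  then show ?thesis by (rule IG_eq_mult)
qed

text \<open>The empty \<open>x\<close> accounts for the adjoined identity. Letting \<open>x\<close>
  range over all lists adds nothing, as equality with \<open>s\<close> forces its letters into the
  carrier.\<close>

lemma mem_left_ideal_IG_word:
  assumes "s \<in> nonempty_words (carrier \<E>)" "t \<in> nonempty_words (carrier \<E>)"
  shows "IG_word \<E> s \<in> left_ideal (IG \<E>) (IG_word \<E> t) \<longleftrightarrow> (\<exists>x. IG_eq \<E> s (x @ t))"
proof -
  have "IG_word \<E> s \<in> left_ideal (IG \<E>) (IG_word \<E> t) \<longleftrightarrow> IG_word \<E> s = IG_word \<E> t \<or>
      (\<exists>x \<in> nonempty_words (carrier \<E>). IG_word \<E> s = IG_word \<E> (x @ t))"
    using IG_word_mult[OF _ assms(2)] unfolding left_ideal_def carrier_IG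
    by (simp add: bex_simps(6)) blast
  also have "\<dots> \<longleftrightarrow> (\<exists>x \<in> lists (carrier \<E>). IG_word \<E> s = IG_word \<E> (x @ t))"
    by (metis Diff_iff append_Nil append_Nil2 empty_iff insert_iff lists.Nil)
  also have "\<dots> \<longleftrightarrow> (\<exists>x \<in> lists (carrier \<E>). IG_eq \<E> s (x @ t))"
    using assms IG_word_eq_iff by (intro bex_cong) auto
  also have "\<dots> \<longleftrightarrow> (\<exists>x. IG_eq \<E> s (x @ t))"
    using IG_eq_lists[OF bio, of s] assms(1) by (metis Diff_iff append_in_lists_conv)
  finally show ?thesis .
qed

lemma mem_right_ideal_IG_word:
  assumes "s \<in> nonempty_words (carrier \<E>)" "t \<in> nonempty_words (carrier \<E>)"
  shows "IG_word \<E> s \<in> right_ideal (IG \<E>) (IG_word \<E> t) \<longleftrightarrow> (\<exists>x. IG_eq \<E> s (t @ x))"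
proof -
  have "IG_word \<E> s \<in> right_ideal (IG \<E>) (IG_word \<E> t) \<longleftrightarrow> IG_word \<E> s = IG_word \<E> t \<or>
      (\<exists>x \<in> nonempty_words (carrier \<E>). IG_word \<E> s = IG_word \<E> (t @ x))"
    using IG_word_mult[OF assms(2)] unfolding right_ideal_def carrier_IG
    by (simp add: bex_simps(6)) blast
  also have "\<dots> \<longleftrightarrow> (\<exists>x \<in> lists (carrier \<E>). IG_word \<E> s = IG_word \<E> (t @ x))"
    by (metis Diff_iff append_Nil append_Nil2 empty_iff insert_iff lists.Nil)
  also have "\<dots> \<longleftrightarrow> (\<exists>x \<in> lists (carrier \<E>). IG_eq \<E> s (t @ x))"
    using assms IG_word_eq_iff by (intro bex_cong) auto
  also have "\<dots> \<longleftrightarrow> (\<exists>x. IG_eq \<E> s (t @ x))"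
    using IG_eq_lists[OF bio, of s] assms(1) by (metis Diff_iff append_in_lists_conv)
  finally show ?thesis .
qed

lemma sgrp_IG: "sgrp (IG \<E>)"
  by (simp add: IG_def sgrp_presented)

lemma left_ideal_eq_iff:
  assumes "a \<in> carrier (IG \<E>)" "b \<in> carrier (IG \<E>)"
  shows "left_ideal (IG \<E>) a = left_ideal (IG \<E>) b \<longleftrightarrow>
    a \<in> left_ideal (IG \<E>) b \<and> b \<in> left_ideal (IG \<E>) a"
proof -
  interpret sgrp "IG \<E>" by (rule sgrp_IG)
  have "left_ideal (IG \<E>) c \<subseteq> left_ideal (IG \<E>) d"
    if "c \<in> left_ideal (IG \<E>) d" "d \<in> carrier (IG \<E>)" for c d
    using that by (auto simp: left_ideal_def mult_assoc[symmetric]) (metis mult_assoc mult_closed)+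
  moreover have "c \<in> left_ideal (IG \<E>) c" for c by (simp add: left_ideal_def)
  ultimately show ?thesis using assms by (metis subset_antisym)
qed

lemma right_ideal_eq_iff:
  assumes "a \<in> carrier (IG \<E>)" "b \<in> carrier (IG \<E>)"
  shows "right_ideal (IG \<E>) a = right_ideal (IG \<E>) b \<longleftrightarrow>
    a \<in> right_ideal (IG \<E>) b \<and> b \<in> right_ideal (IG \<E>) a"
proof -
  interpret sgrp "IG \<E>" by (rule sgrp_IG)
  have "right_ideal (IG \<E>) c \<subseteq> right_ideal (IG \<E>) d"
    if "c \<in> right_ideal (IG \<E>) d" "d \<in> carrier (IG \<E>)" for c d
    using that by (auto simp: right_ideal_def) (metis mult_assoc mult_closed)+
  moreover have "c \<in> right_ideal (IG \<E>) c" for c by (simp add: right_ideal_def)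
  ultimately show ?thesis using assms by (metis subset_antisym)
qed

lemma green_L_IG_word:
  assumes "s \<in> nonempty_words (carrier \<E>)" "t \<in> nonempty_words (carrier \<E>)"
  shows "green_L (IG \<E>) (IG_word \<E> s) (IG_word \<E> t) \<longleftrightarrow>
    (\<exists>x. IG_eq \<E> s (x @ t)) \<and> (\<exists>x. IG_eq \<E> t (x @ s))"
proof -
  have c: "IG_word \<E> s \<in> carrier (IG \<E>)" "IG_word \<E> t \<in> carrier (IG \<E>)"
    using assms by (simp_all add: IG_word_in_carrier)
  show ?thesis
    using c by (simp only: green_L_def left_ideal_eq_iff[OF c] mem_left_ideal_IG_word assms simp_thms)
qed

lemma green_R_IG_word:
  assumes "s \<in> nonempty_words (carrier \<E>)" "t \<in> nonempty_words (carrier \<E>)"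
  shows "green_R (IG \<E>) (IG_word \<E> s) (IG_word \<E> t) \<longleftrightarrow>
    (\<exists>x. IG_eq \<E> s (t @ x)) \<and> (\<exists>x. IG_eq \<E> t (s @ x))"
proof -
  have c: "IG_word \<E> s \<in> carrier (IG \<E>)" "IG_word \<E> t \<in> carrier (IG \<E>)"
    using assms by (simp_all add: IG_word_in_carrier)
  show ?thesis
    using c by (simp only: green_R_def right_ideal_eq_iff[OF c] mem_right_ideal_IG_word assms simp_thms)
qed

text \<open>Half of each Green relation is automatic: \<open>u e\<close> is a left multiple of
  \<open>e\<close>, and \<open>e v\<close> a right multiple. Only the converse divisibilities carry
  content.\<close>

lemma seed_iff_green:
  assumes "u \<in> lists (carrier \<E>)" "v \<in> lists (carrier \<E>)" "e \<in> carrier \<E>"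
  shows "seed \<E> u e v \<longleftrightarrow>
    green_L (IG \<E>) (IG_word \<E> (u @ [e])) (IG_word \<E> [e]) \<and>
    green_R (IG \<E>) (IG_word \<E> [e]) (IG_word \<E> ([e] @ v))"
proof -
  have "\<exists>x. IG_eq \<E> (u @ [e]) (x @ [e])" by (rule exI[of _ u]) simp
  then have "green_L (IG \<E>) (IG_word \<E> (u @ [e])) (IG_word \<E> [e]) \<longleftrightarrow> (\<exists>x. IG_eq \<E> [e] (x @ u @ [e]))"
    by (subst green_L_IG_word) (use assms in auto)
  moreover have "\<exists>x. IG_eq \<E> ([e] @ v) ([e] @ x)" by (rule exI[of _ v]) simp
  then have "green_R (IG \<E>) (IG_word \<E> [e]) (IG_word \<E> ([e] @ v)) \<longleftrightarrow>
      (\<exists>y. IG_eq \<E> [e] ([e] @ v @ y))"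
    by (subst green_R_IG_word) (use assms in auto)
  ultimately show ?thesis by (simp add: seed_def)
qed

text \<open>The intermediate element is \<open>u e\<close>: it is \<L>-related to \<open>e\<close>,
  and multiplying \<open>e = e v y\<close> by \<open>u\<close> on the left makes it \<R>-related to
  \<open>u e v\<close>.\<close>

lemma seed_imp_green_D:
  assumes "seed \<E> u e v"
    and uv: "u \<in> lists (carrier \<E>)" "v \<in> lists (carrier \<E>)" "e \<in> carrier \<E>"
  shows "green_D (IG \<E>) (IG_word \<E> [e]) (IG_word \<E> (u @ [e] @ v))"
proof -
  have L: "green_L (IG \<E>) (IG_word \<E> [e]) (IG_word \<E> (u @ [e]))"
    using assms seed_iff_green[OF uv] by (simp add: green_L_def)
  obtain y where "IG_eq \<E> [e] ([e] @ v @ y)"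
    using assms(1) unfolding seed_def by blast
  then have "IG_eq \<E> (u @ [e]) ((u @ [e] @ v) @ y)"
    using IG_eq_append[OF IG_eq_refl] by fastforce
  moreover have "IG_eq \<E> (u @ [e] @ v) ((u @ [e]) @ v)" by simp
  moreover have "u @ [e] \<in> nonempty_words (carrier \<E>)" "u @ [e] @ v \<in> nonempty_words (carrier \<E>)"
    using uv by auto
  ultimately have "green_R (IG \<E>) (IG_word \<E> (u @ [e])) (IG_word \<E> (u @ [e] @ v))"
    using green_R_IG_word by blast
  with L show ?thesis unfolding green_D_def by blast
qed

section \<open>Regular elements in terms of words\<close>

lemma regular_IG_word_iff:
  assumes "w \<in> lists (carrier \<E>)"
  shows "regular_element (IG \<E>) (IG_word \<E> w) \<longleftrightarrow>
    w \<noteq> [] \<and> (\<exists>w' \<in> nonempty_words (carrier \<E>). IG_eq \<E> (w @ w' @ w) w)"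
proof (cases "w = []")
  case True
  then show ?thesis using IG_word_in_carrier[of \<E> w] by (simp add: regular_element_def)
next
  case False
  then have w: "w \<in> nonempty_words (carrier \<E>)" using assms by simp
  have "(IG_word \<E> w \<cdot>\<^bsub>IG \<E>\<^esub> IG_word \<E> w') \<cdot>\<^bsub>IG \<E>\<^esub> IG_word \<E> w = IG_word \<E> w \<longleftrightarrow>
      IG_eq \<E> (w @ w' @ w) w" if w': "w' \<in> nonempty_words (carrier \<E>)" for w'
  proof -
    have "w @ w' \<in> nonempty_words (carrier \<E>)" "(w @ w') @ w \<in> nonempty_words (carrier \<E>)"
      using w w' by auto
    then show ?thesis
      using IG_word_eq_iff[of "(w @ w') @ w" w] by (simp only: IG_word_mult w w' append_assoc)
  qed
  then show ?thesis
    using w False IG_word_in_carrier[of \<E> w] by (simp add: regular_element_def carrier_IG)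
qed

lemma regular_IG_word_iff_seed:
  assumes "w \<in> lists (carrier \<E>)"
  shows "regular_element (IG \<E>) (IG_word \<E> w) \<longleftrightarrow> (\<exists>u e v. w = u @ [e] @ v \<and> seed \<E> u e v)"
proof
  assume "regular_element (IG \<E>) (IG_word \<E> w)"
  then show "\<exists>u e v. w = u @ [e] @ v \<and> seed \<E> u e v"
    using regular_IG_word_iff[OF assms] regular_imp_seed[OF bio] by blast
next
  assume "\<exists>u e v. w = u @ [e] @ v \<and> seed \<E> u e v"
  then obtain u e v where w: "w = u @ [e] @ v" and s: "seed \<E> u e v" by blast
  then have "IG_eq \<E> [e, e] [e]" using assms idempotent_letter by auto
  from seed_imp_regular[OF s this] obtain w' where w': "w' \<noteq> []" "IG_eq \<E> (w @ w' @ w) w"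
    unfolding w[symmetric] by blast
  \<comment> \<open>The inverse comes without a bound on its letters; since equality preserves words
    over the carrier, \<open>w w' w = w\<close> supplies it.\<close>
  have "w @ w' @ w \<in> lists (carrier \<E>)"
    using IG_eq_lists[OF bio IG_eq_sym[OF w'(2)] assms] .
  then show "regular_element (IG \<E>) (IG_word \<E> w)"
    using w' w regular_IG_word_iff[OF assms] by auto
qed

end

theorem theorem3p6:
  fixes \<E> :: "'a partial_algebra" and w :: "'a list"
  assumes "biordered_set \<E>"
    and "w \<in> lists (carrier \<E>)"
  shows "(regular_element (IG \<E>) (IG_word \<E> w) \<longleftrightarrow>
           (\<exists>u \<in> lists (carrier \<E>). \<exists>v \<in> lists (carrier \<E>). \<exists>e \<in> carrier \<E>.
              w = u @ [e] @ v \<and>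
              green_L (IG \<E>) (IG_word \<E> (u @ [e])) (IG_word \<E> [e]) \<and>
              green_R (IG \<E>) (IG_word \<E> [e]) (IG_word \<E> ([e] @ v))))
       \<and> (\<forall>u \<in> lists (carrier \<E>). \<forall>v \<in> lists (carrier \<E>). \<forall>e \<in> carrier \<E>.
              w = u @ [e] @ v \<and>
              green_L (IG \<E>) (IG_word \<E> (u @ [e])) (IG_word \<E> [e]) \<and>
              green_R (IG \<E>) (IG_word \<E> [e]) (IG_word \<E> ([e] @ v))
              \<longrightarrow> green_D (IG \<E>) (IG_word \<E> [e]) (IG_word \<E> w))"
proof (intro conjI ballI impI)
  \<comment> \<open>Factors of a word over the carrier are again over the carrier, so bounded and
    unbounded quantifiers agree.\<close>
  have "(\<exists>u e v. w = u @ [e] @ v \<and> seed \<E> u e v) \<longleftrightarrow>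
      (\<exists>u \<in> lists (carrier \<E>). \<exists>v \<in> lists (carrier \<E>). \<exists>e \<in> carrier \<E>.
         w = u @ [e] @ v \<and> seed \<E> u e v)"
    using assms(2) by fastforce
  then show "regular_element (IG \<E>) (IG_word \<E> w) \<longleftrightarrow>
      (\<exists>u \<in> lists (carrier \<E>). \<exists>v \<in> lists (carrier \<E>). \<exists>e \<in> carrier \<E>.
         w = u @ [e] @ v \<and>
         green_L (IG \<E>) (IG_word \<E> (u @ [e])) (IG_word \<E> [e]) \<and>
         green_R (IG \<E>) (IG_word \<E> [e]) (IG_word \<E> ([e] @ v)))"
    using regular_IG_word_iff_seed[OF assms] seed_iff_green[OF assms(1)] by (metis (no_types, lifting))
next
  fix u v e
  assume "u \<in> lists (carrier \<E>)" "v \<in> lists (carrier \<E>)" "e \<in> carrier \<E>"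
    and "w = u @ [e] @ v \<and>
      green_L (IG \<E>) (IG_word \<E> (u @ [e])) (IG_word \<E> [e]) \<and>
      green_R (IG \<E>) (IG_word \<E> [e]) (IG_word \<E> ([e] @ v))"
  then show "green_D (IG \<E>) (IG_word \<E> [e]) (IG_word \<E> w)"
    using seed_iff_green[OF assms(1)] seed_imp_green_D[OF assms(1)] by blast
qed

end
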